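(* For $n\ge0$ let $C_n^{(4)}=\frac{4}{2n+4}\binom{2n+4}{n}$ and let $D(n,4)=\det\bigl(C_{i+j}^{(4)}\bigr)_{i,j=0}^{n-1}$. Then $(D(n,4))_{n\ge 0}=(1,1,-2,-2,3,3,-4,-4,\dots)$, i.e. for all integers $n\ge 0$ $$D(2n,4)=D(2n+1,4)=(-1)^n(n+1).$$
   Context: The numbers $C_n^{(4)}$ are the coefficients of the fourth power of the Catalan generating function: $\sum_{n\ge0}C_n^{(4)}z^n=\bigl(\sum_{n\ge0}C_nz^n\bigr)^4$ with $C_n=\frac1{n+1}\binom{2n}{n}$. The determinant of the empty ($0\times 0$) matrix is $1$. *)

theory Defs
  imports "Jordan_Normal_Form.Determinant"
begin

(* Taken by its closed form; equivalently, the coefficient of z^n in the fourth power of the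
   Catalan generating function.  The values are integers, but the division is exact only in
   the product as a whole, hence the rational type. *)
definition catalan4 :: "nat \<Rightarrow> rat" where
  "catalan4 n = 4 / of_nat (2 * n + 4) * of_nat ((2 * n + 4) choose n)"

definition hankel_matrix :: "(nat \<Rightarrow> 'a) \<Rightarrow> nat \<Rightarrow> 'a mat" where
  "hankel_matrix a n = mat n n (\<lambda>(i, j). a (i + j))"

(* The matrix is empty for n = 0, with determinant 1. *)
definition D4 :: "nat \<Rightarrow> rat" where
  "D4 n = det (hankel_matrix catalan4 n)"

end

theory Submission
  imports Defs
begin

text \<open>
  Let \<open>J\<close> be the adjacency matrix of the path \<open>0 - 1 - 2 - \<dots>\<close> and \<open>X = J + 2\<close>. The entries
  of \<open>X ^ i\<close> are ballot numbers \<open>b i k = (X ^ i) 0 k\<close>, and \<open>catalan4 n = (X ^ n J X) 0 0\<close>.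
  Splitting \<open>X ^ (i + j)\<close> shows that the Hankel matrix is \<open>B W B\<^sup>T\<close>, where \<open>B\<close> is lower
  unitriangular and \<open>W\<close> is the \<open>n \<times> n\<close> truncation of \<open>J X\<close>. This truncation differs from
  the product of the truncations of \<open>J\<close> and \<open>X\<close> only by \<open>1\<close> in the last diagonal entry, so
  \<open>det W\<^sub>n = det J\<^sub>n det X\<^sub>n + det W\<^sub>n\<^sub>-\<^sub>1\<close>, and both tridiagonal determinants are Chebyshev values.
\<close>

subsection \<open>Tridiagonal matrices\<close>

text \<open>One family covers both matrices: \<open>a = 0\<close> gives \<open>J\<close> and
  \<open>a = 2\<close> gives \<open>X\<close>.\<close>

definition path_entry :: "'a::comm_ring_1 \<Rightarrow> nat \<Rightarrow> nat \<Rightarrow> 'a" where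
  "path_entry a i j = (if i = j then a else if i = Suc j \<or> j = Suc i then 1 else 0)"

definition path_mat :: "'a::comm_ring_1 \<Rightarrow> nat \<Rightarrow> 'a mat" where
  "path_mat a n = mat n n (\<lambda>(i, j). path_entry a i j)"

lemma path_mat_carrier [simp]: "path_mat a n \<in> carrier_mat n n"
  by (simp add: path_mat_def)

lemma path_entry_commute: "path_entry a i j = path_entry a j i"
  by (auto simp: path_entry_def)

lemma sum_path_entry_0:
  assumes "2 \<le> N"
  shows "(\<Sum>m<N. path_entry a 0 m * f m) = a * f 0 + f 1"
proof -
  have "(\<Sum>m<N. path_entry a 0 m * f m) = (\<Sum>m\<in>{0, 1}. path_entry a 0 m * f m)"
    using assms by (intro sum.mono_neutral_right) (auto simp: path_entry_def)
  then show ?thesis by (simp add: path_entry_def)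
qed

lemma sum_path_entry_Suc:
  assumes "k + 3 \<le> N"
  shows "(\<Sum>m<N. path_entry a (Suc k) m * f m) = f k + a * f (Suc k) + f (Suc (Suc k))"
proof -
  have "(\<Sum>m<N. path_entry a (Suc k) m * f m)
      = (\<Sum>m\<in>{k, Suc k, Suc (Suc k)}. path_entry a (Suc k) m * f m)"
    using assms by (intro sum.mono_neutral_right) (auto simp: path_entry_def)
  then show ?thesis by (simp add: path_entry_def algebra_simps)
qed

lemma det_path_mat_rec:
  "det (path_mat a (Suc (Suc n))) = a * det (path_mat a (Suc n)) - det (path_mat a n)"
proof -
  let ?M = "path_mat a (Suc (Suc n))"
  let ?N = "mat_delete ?M (Suc n) n"
  have "det ?M = (\<Sum>j<Suc (Suc n). ?M $$ (Suc n, j) * cofactor ?M (Suc n) j)"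
    by (rule laplace_expansion_row) auto
  also have "\<dots> = ?M $$ (Suc n, n) * cofactor ?M (Suc n) n
      + ?M $$ (Suc n, Suc n) * cofactor ?M (Suc n) (Suc n)"
    by (simp add: sum.neutral path_mat_def path_entry_def)
  also have "\<dots> = a * det (mat_delete ?M (Suc n) (Suc n)) - det ?N"
    by (simp add: cofactor_def path_mat_def path_entry_def)
  also have "mat_delete ?M (Suc n) (Suc n) = path_mat a (Suc n)"
    by (rule eq_matI) (auto simp: mat_delete_def path_mat_def)
  \<comment> \<open>The last column of \<open>?N\<close> is the old column \<open>Suc n\<close>
    without its last entry, so only the 1 in row \<open>n\<close> survives in it.\<close>
  also have "det ?N = det (path_mat a n)"
  proof -
    have "det ?N = (\<Sum>i<Suc n. ?N $$ (i, n) * cofactor ?N i n)"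
      by (rule laplace_expansion_column) (auto simp: mat_delete_def path_mat_def)
    also have "\<dots> = ?N $$ (n, n) * cofactor ?N n n"
      by (simp add: sum.neutral mat_delete_def path_mat_def path_entry_def)
    also have "\<dots> = det (mat_delete ?N n n)"
      by (simp add: cofactor_def mat_delete_def path_mat_def path_entry_def)
    also have "mat_delete ?N n n = path_mat a n"
      by (rule eq_matI) (auto simp: mat_delete_def path_mat_def)
    finally show ?thesis .
  qed
  finally show ?thesis .
qed

lemma det_path_mat_0 [simp]: "det (path_mat a 0) = 1"
  by (simp add: path_mat_def det_dim_zero)

lemma det_path_mat_1 [simp]: "det (path_mat a (Suc 0)) = a"
  by (simp add: path_mat_def path_entry_def det_single)

lemma det_path_mat_two:
  "det (path_mat (2 :: 'a::comm_ring_1) n) = of_nat (n + 1)"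
proof (induction n rule: less_induct)
  case (less n)
  show ?case
  proof (cases "n < 2")
    case True
    then have "n = 0 \<or> n = Suc 0" by auto
    then show ?thesis by auto
  next
    case False
    then obtain k where "n = Suc (Suc k)"
      by (metis add_2_eq_Suc le_Suc_ex not_less)
    then show ?thesis
      using less[of k] less[of "Suc k"] by (simp add: det_path_mat_rec algebra_simps)
  qed
qed

lemma det_path_mat_zero:
  "det (path_mat (0 :: 'a::comm_ring_1) (2 * n)) = (- 1) ^ n
    \<and> det (path_mat (0 :: 'a) (2 * n + 1)) = 0"
  by (induction n) (simp_all add: det_path_mat_rec)

subsection \<open>Ballot numbers\<close>

text \<open>Reflection principle: this counts the walks of \<open>2 * i\<close> steps of size 1 from
  height 0 to height \<open>2 * k\<close> that never reach -2. Two such steps make one application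
  of \<open>X\<close>.\<close>

definition ballot :: "nat \<Rightarrow> nat \<Rightarrow> rat" where
  "ballot i k = of_nat (2 * i choose (i + k)) - of_nat (2 * i choose (i + k + 2))"

lemma ballot_eq_0: "i < k \<Longrightarrow> ballot i k = 0"
  by (simp add: ballot_def binomial_eq_0)

lemma ballot_diag: "ballot i i = 1"
  by (simp add: ballot_def binomial_eq_0 flip: mult_2)

lemma ballot_0: "ballot 0 k = (if k = 0 then 1 else 0)"
  by (simp add: ballot_eq_0 ballot_diag)

text \<open>At the boundary, applying Pascal's rule twice leaves
  \<open>2 * i choose (i - 1)\<close>, which symmetry turns into the
  \<open>2 * i choose (i + 1)\<close> of \<open>ballot i 1\<close>.\<close>

lemma ballot_Suc_0: "ballot (Suc i) 0 = 2 * ballot i 0 + ballot i 1"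
proof (cases i)
  case 0
  then show ?thesis by (simp add: ballot_def)
next
  case (Suc m)
  have "2 * i choose m = 2 * i choose (2 * i - m)"
    by (rule binomial_symmetric) (simp add: Suc)
  also have "2 * i - m = Suc (Suc m)" using Suc by simp
  finally have sym: "2 * i choose m = 2 * i choose Suc (Suc m)" .
  define N where "N = 2 * i"
  have "2 * Suc i = Suc (Suc N)" by (simp add: N_def)
  then show ?thesis
    unfolding ballot_def using sym by (simp add: Suc flip: N_def)
qed

lemma ballot_Suc_Suc:
  "ballot (Suc i) (Suc k) = ballot i k + 2 * ballot i (Suc k) + ballot i (Suc (Suc k))"
  by (simp add: ballot_def)

lemma sum_path_entry_ballot:
  assumes "k < N" "i < N"
  shows "(\<Sum>m<N. path_entry 2 k m * ballot i m) = ballot (Suc i) k"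
proof -
  \<comment> \<open>Two vanishing terms are appended so that both neighbours of \<open>k\<close> lie
    in the range, even for \<open>k = N - 1\<close>.\<close>
  have "(\<Sum>m<N. path_entry 2 k m * ballot i m)
      = (\<Sum>m<N + 2. path_entry 2 k m * ballot i m)"
    using assms by (intro sum.mono_neutral_left) (auto simp: ballot_eq_0)
  also have "\<dots> = ballot (Suc i) k"
  proof (cases k)
    case 0
    then show ?thesis using assms by (simp only: sum_path_entry_0 ballot_Suc_0)
  next
    case (Suc l)
    then show ?thesis using assms by (simp only: sum_path_entry_Suc ballot_Suc_Suc)
  qed
  finally show ?thesis .
qed

lemma binomial_step:
  "(of_nat (Suc k) :: rat) * of_nat (n choose Suc k) = (of_nat n - of_nat k) * of_nat (n choose k)"
proof (cases "k \<le> n")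
  case True
  have "Suc k * (n choose Suc k) = (n - k) * (n choose k)"
    by (simp only: binomial_absorption binomial_absorb_comp)
  then have "(of_nat (Suc k * (n choose Suc k)) :: rat) = of_nat ((n - k) * (n choose k))"
    by (rule arg_cong)
  then show ?thesis using True by (simp only: of_nat_mult of_nat_diff)
qed (simp add: binomial_eq_0)

lemma catalan4_eq_ballot: "catalan4 n = ballot (Suc n) 1"
proof -
  let ?x = "of_nat n :: rat"
  let ?N = "2 * n + 2"
  \<comment> \<open>Three neighbours in one row of Pascal's triangle: both sides are linear in them,
    and the ratios of neighbours make everything a rational multiple of \<open>p\<close>.\<close>
  define p q r :: rat where "p = of_nat (?N choose (n + 2))"
    and "q = of_nat (?N choose (n + 3))" and "r = of_nat (?N choose (n + 4))"
  have "?x + 2 > 0" "?x + 3 > 0" "?x + 4 > 0" by (simp_all add: add_nonneg_pos)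
  then have nz: "?x + 2 \<noteq> 0" "?x + 3 \<noteq> 0" "?x + 4 \<noteq> 0" by linarith+
  have "(?x + 3) * q = ?x * p"
    using binomial_step[of "n + 2" ?N] by (simp add: p_def q_def eval_nat_numeral algebra_simps)
  then have q: "q = ?x * p / (?x + 3)"
    using nz by (simp add: field_simps)
  have "(?x + 4) * r = (?x - 1) * q"
    using binomial_step[of "n + 3" ?N] by (simp add: r_def q_def eval_nat_numeral algebra_simps)
  then have r: "r = (?x - 1) * q / (?x + 4)"
    using nz by (simp add: field_simps)
  have "(2 * n + 4) choose n = (2 * n + 4) choose (n + 4)"
    using binomial_symmetric[of n "2 * n + 4"] by simp
  then have "of_nat ((2 * n + 4) choose n) = r + 2 * q + p"
    by (simp add: p_def q_def r_def eval_nat_numeral)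
  then have "catalan4 n = 4 / (2 * ?x + 4) * (r + 2 * q + p)"
    by (simp add: catalan4_def)
  also have "\<dots> = 2 / (?x + 2) * (r + 2 * q + p)"
    using nz by (simp add: field_simps)
  also have "\<dots> = p - r"
    using nz unfolding r q by (simp add: divide_simps) (simp add: algebra_simps)
  also have "\<dots> = ballot (Suc n) 1"
    by (simp add: ballot_def p_def r_def eval_nat_numeral)
  finally show ?thesis .
qed

subsection \<open>Factorization of the Hankel matrix\<close>

text \<open>The symmetric matrix \<open>X\<close> can be moved from one factor of the scalar product to the other.\<close>

lemma sum_ballot_mult:
  assumes g: "\<And>j k N. k + 2 \<le> N \<Longrightarrow> g (Suc j) k = (\<Sum>m<N. path_entry 2 k m * g j m)"
    and "i < N"
  shows "(\<Sum>k<N. ballot i k * g j k) = g (i + j) 0"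
proof -
  have "\<forall>N j. i < N \<longrightarrow> (\<Sum>k<N. ballot i k * g j k) = g (i + j) 0"
  proof (induction i)
    case 0
    have "(\<Sum>k<N. ballot 0 k * g j k) = (\<Sum>k\<in>{0}. ballot 0 k * g j k)" if "0 < N" for N j
      using that by (intro sum.mono_neutral_right) (auto simp: ballot_0)
    then show ?case by (simp add: ballot_0)
  next
    case (Suc i)
    show ?case
    proof (intro allI impI)
      fix N j assume N: "Suc i < N"
      have "(\<Sum>k<N. ballot (Suc i) k * g j k)
          = (\<Sum>k<N. \<Sum>m<N. path_entry 2 k m * ballot i m * g j k)"
        using N by (simp add: sum_path_entry_ballot flip: sum_distrib_right)
      also have "\<dots> = (\<Sum>m<N. ballot i m * (\<Sum>k<N. path_entry 2 m k * g j k))"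
        by (subst sum.swap) (simp add: sum_distrib_left path_entry_commute mult_ac)
      also have "\<dots> = (\<Sum>m<N. ballot i m * g (Suc j) m)"
      proof (rule sum.cong[OF refl])
        fix m assume "m \<in> {..<N}"
        show "ballot i m * (\<Sum>k<N. path_entry 2 m k * g j k) = ballot i m * g (Suc j) m"
        \<comment> \<open>The recurrence for \<open>g\<close> needs \<open>m + 2\<close> to be at
          most \<open>N\<close>, which can fail only where \<open>ballot i m\<close>
          vanishes.\<close>
        proof (cases "m \<le> i")
          case True
          then show ?thesis using N by (simp add: g[of m N])
        qed (simp add: ballot_eq_0)
      qed
      also have "\<dots> = g (Suc i + j) 0" using Suc.IH N by simp
      finally show "(\<Sum>k<N. ballot (Suc i) k * g j k) = g (Suc i + j) 0" .
    qed
  qed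
  then show ?thesis using assms(2) by blast
qed

text \<open>
  The sum has \<open>n + 1\<close> terms: this is the \<open>n \<times> n\<close> corner of the product of the infinite matrices.
\<close>

definition corner_mat :: "nat \<Rightarrow> rat mat" where
  "corner_mat n = mat n n (\<lambda>(k, l). \<Sum>m<Suc n. path_entry 0 k m * path_entry 2 m l)"

lemma corner_mat_carrier [simp]: "corner_mat n \<in> carrier_mat n n"
  by (simp add: corner_mat_def)

definition ballot_mat :: "nat \<Rightarrow> rat mat" where
  "ballot_mat n = mat n n (\<lambda>(i, k). ballot i k)"

lemma ballot_mat_carrier [simp]: "ballot_mat n \<in> carrier_mat n n"
  by (simp add: ballot_mat_def)

lemma det_ballot_mat: "det (ballot_mat n) = 1"
proof -
  have "det (ballot_mat n) = prod_list (diag_mat (ballot_mat n))"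
    by (rule det_lower_triangular[of n]) (auto simp: ballot_mat_def ballot_eq_0)
  also have "diag_mat (ballot_mat n) = map (\<lambda>i. 1) [0..<n]"
    by (auto simp: diag_mat_def ballot_mat_def ballot_diag)
  finally show ?thesis by (simp add: map_replicate_const)
qed

text \<open>This is \<open>J = X - 2\<close> applied to a row of ballot numbers.\<close>

lemma sum_path_entry_0_ballot:
  assumes "k + 2 \<le> N"
  shows "(\<Sum>m<N. path_entry 0 k m * ballot (Suc j) m)
    = ballot (Suc (Suc j)) k - 2 * ballot (Suc j) k"
  using assms by (cases k) (simp_all add: sum_path_entry_0 sum_path_entry_Suc
      ballot_Suc_0 ballot_Suc_Suc[of "Suc j"])

lemma hankel_factorization:
  "hankel_matrix catalan4 n = ballot_mat n * (corner_mat n * (ballot_mat n)\<^sup>T)"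
proof (rule eq_matI)
  fix i j
  assume "i < dim_row (ballot_mat n * (corner_mat n * (ballot_mat n)\<^sup>T))"
    and "j < dim_col (ballot_mat n * (corner_mat n * (ballot_mat n)\<^sup>T))"
  then have ij: "i < n" "j < n" by (auto simp: ballot_mat_def)
  \<comment> \<open>The entry in row 0 and column \<open>k\<close> of
    \<open>X ^ (j + 1) J\<close>.\<close>
  let ?c = "\<lambda>j k. ballot (Suc (Suc j)) k - 2 * ballot (Suc j) k"
  have W: "(corner_mat n * (ballot_mat n)\<^sup>T) $$ (k, j) = ?c j k" if "k < n" for k
  proof -
    have "(corner_mat n * (ballot_mat n)\<^sup>T) $$ (k, j)
        = (\<Sum>l<n. (\<Sum>m<Suc n. path_entry 0 k m * path_entry 2 m l) * ballot j l)"
      using that ij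
      by (simp add: corner_mat_def ballot_mat_def scalar_prod_def atLeast0LessThan)
    also have "\<dots> = (\<Sum>m<Suc n. path_entry 0 k m * (\<Sum>l<n. path_entry 2 m l * ballot j l))"
      unfolding sum_distrib_left sum_distrib_right by (subst sum.swap) (simp only: mult.assoc)
    \<comment> \<open>The new term has the factor \<open>ballot j n = 0\<close>; the longer range
      makes \<open>sum_path_entry_ballot\<close> applicable to \<open>m = n\<close> as well.\<close>
    also have "\<dots> = (\<Sum>m<Suc n. path_entry 0 k m * (\<Sum>l<Suc n. path_entry 2 m l * ballot j l))"
      using ij by (simp add: ballot_eq_0)
    also have "\<dots> = (\<Sum>m<Suc n. path_entry 0 k m * ballot (Suc j) m)"
      using ij by (intro sum.cong refl) (simp only: sum_path_entry_ballot lessThan_iff less_SucI)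
    also have "\<dots> = ?c j k"
      using that by (intro sum_path_entry_0_ballot) simp
    finally show ?thesis .
  qed
  have "(ballot_mat n * (corner_mat n * (ballot_mat n)\<^sup>T)) $$ (i, j)
      = (\<Sum>k<n. ballot_mat n $$ (i, k) * (corner_mat n * (ballot_mat n)\<^sup>T) $$ (k, j))"
    using ij by (subst index_mult_mat(1))
      (auto simp: ballot_mat_def corner_mat_def scalar_prod_def atLeast0LessThan)
  also have "\<dots> = (\<Sum>k<n. ballot i k * ?c j k)"
    using ij W by (intro sum.cong refl) (simp add: ballot_mat_def)
  also have "\<dots> = ?c (i + j) 0"
  proof (rule sum_ballot_mult)
    fix j k N :: nat assume "k + 2 \<le> N"
    then show "?c (Suc j) k = (\<Sum>m<N. path_entry 2 k m * ?c j m)"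
      by (cases k) (simp_all add: sum_path_entry_0 sum_path_entry_Suc
          ballot_Suc_0[of "Suc _"] ballot_Suc_Suc[of "Suc _"])
  qed (rule ij)
  also have "\<dots> = catalan4 (i + j)"
    by (simp add: catalan4_eq_ballot ballot_Suc_0[of "Suc _"])
  finally show "hankel_matrix catalan4 n $$ (i, j)
      = (ballot_mat n * (corner_mat n * (ballot_mat n)\<^sup>T)) $$ (i, j)"
    using ij by (simp add: hankel_matrix_def)
qed (auto simp: hankel_matrix_def ballot_mat_def)

section \<open>Determinants of the truncations of \<open>J X\<close>\<close>

lemma D4_eq_det_corner_mat: "D4 n = det (corner_mat n)"
proof -
  have "D4 n = det (ballot_mat n) * det (corner_mat n * (ballot_mat n)\<^sup>T)"
    unfolding D4_def hankel_factorization
    by (rule det_mult[of _ n]) (auto intro!: mult_carrier_mat[of _ n n])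
  also have "det (corner_mat n * (ballot_mat n)\<^sup>T) = det (corner_mat n) * det ((ballot_mat n)\<^sup>T)"
    by (rule det_mult[of _ n]) simp_all
  also have "det ((ballot_mat n)\<^sup>T) = det (ballot_mat n)"
    by (rule det_transpose[of _ n]) simp
  finally show ?thesis by (simp add: det_ballot_mat)
qed

text \<open>The extra summation index \<open>Suc n\<close> has \<open>n\<close> as its only
  neighbour among the row and column indices.\<close>

lemma corner_mat_eq:
  assumes "k < Suc n" "l < Suc n"
  shows "corner_mat (Suc n) $$ (k, l)
    = (path_mat 0 (Suc n) * path_mat 2 (Suc n)) $$ (k, l) + (if k = n \<and> l = n then 1 else 0)"
  using assms
  by (auto simp: corner_mat_def path_mat_def scalar_prod_def atLeast0LessThan)
    (auto simp: path_entry_def)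

text \<open>The determinant is linear in the last row, so the additional 1 in the corner contributes
  its cofactor.\<close>

lemma det_corner_mat_Suc:
  "det (corner_mat (Suc n))
    = det (path_mat 0 (Suc n)) * det (path_mat 2 (Suc n)) + det (corner_mat n)"
proof -
  let ?W = "corner_mat (Suc n)"
  define P where "P = path_mat 0 (Suc n) * path_mat (2 :: rat) (Suc n)"
  have P: "P \<in> carrier_mat (Suc n) (Suc n)"
    unfolding P_def by (rule mult_carrier_mat[of _ _ "Suc n"]) simp_all
  have W: "?W \<in> carrier_mat (Suc n) (Suc n)"
    by simp
  have W_eq: "?W $$ (k, l) = P $$ (k, l) + (if k = n \<and> l = n then 1 else 0)"
    if "k < Suc n" "l < Suc n" for k l
    using corner_mat_eq[OF that] by (simp only: P_def)
  have del: "mat_delete P n j = mat_delete ?W n j" for j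
    using carrier_matD[OF P] carrier_matD[OF W]
    by (intro eq_matI) (auto simp: mat_delete_def W_eq)
  \<comment> \<open>The sums in \<open>?W\<close> run one index further, but \<open>Suc n\<close> is
    not adjacent to any index below \<open>n\<close>.\<close>
  have "mat_delete ?W n n = corner_mat n"
    by (intro eq_matI) (auto simp: mat_delete_def corner_mat_def path_entry_def)
  then have cof: "cofactor ?W n n = det (corner_mat n)"
    by (simp add: cofactor_def)
  have "det ?W = (\<Sum>j<Suc n. ?W $$ (n, j) * cofactor ?W n j)"
    by (rule laplace_expansion_row) simp_all
  also have "\<dots> = (\<Sum>j<Suc n. P $$ (n, j) * cofactor P n j) + det (corner_mat n)"
    using cof by (simp add: W_eq cofactor_def del algebra_simps)
  also have "(\<Sum>j<Suc n. P $$ (n, j) * cofactor P n j) = det P"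
    by (rule laplace_expansion_row[symmetric]) (use P in simp_all)
  also have "det P = det (path_mat 0 (Suc n)) * det (path_mat 2 (Suc n))"
    unfolding P_def by (rule det_mult[of _ "Suc n"]) simp_all
  finally show ?thesis .
qed

theorem theorem7p3:
  fixes n :: nat
  shows "D4 (2 * n) = (- 1) ^ n * of_nat (n + 1)
       \<and> D4 (2 * n + 1) = (- 1) ^ n * of_nat (n + 1)"
proof -
  \<comment> \<open>Truncations of \<open>J\<close> of odd order are singular, so the product term
    drops out.\<close>
  have odd: "D4 (2 * n + 1) = D4 (2 * n)" for n
    using det_corner_mat_Suc[of "2 * n"] det_path_mat_zero[of n, where 'a = rat]
    by (simp add: D4_eq_det_corner_mat)
  have "D4 (2 * n) = (- 1) ^ n * of_nat (n + 1)"
  proof (induction n)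
    case 0
    show ?case by (simp add: D4_def hankel_matrix_def det_dim_zero)
  next
    case (Suc n)
    \<comment> \<open>With the value \<open>(- 1) ^ n * (n + 1)\<close> of the last term, the sum is
      \<open>(- 1) ^ Suc n * ((2 * n + 3) - (n + 1))\<close>.\<close>
    have "D4 (2 * Suc n) = (- 1) ^ Suc n * of_nat (2 * Suc n + 1) + D4 (2 * n + 1)"
      using det_corner_mat_Suc[of "2 * n + 1"] det_path_mat_zero[of "Suc n", where 'a = rat]
        det_path_mat_two[of "2 * Suc n", where 'a = rat]
      by (simp add: D4_eq_det_corner_mat)
    then show ?case
      unfolding odd Suc.IH by (simp add: algebra_simps)
  qed
  then show ?thesis using odd by simp
qed

end
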